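(* Let $m<n$, let $A\in\mathbb{R}^{m\times n}$ have full rank $m$ (so that $AA^*$ is invertible), let $y\in\mathbb{R}^m$ and $\tau>0$. Assume that the problem $\min\|x\|_{l_1}$ subject to $Ax=y$ has a unique minimizer $\bar x\in\mathbb{R}^n$. Let $x\in\mathbb{R}^n$ and, for $\Delta t>0$, let the sequences $(x_k)_{k\ge0}\subset\mathbb{R}^n$, $(z_k)_{k\ge 0}\subset\mathbb{R}^m$ solve the implicit scheme $$\frac{x_{k+1}-x_k}{\Delta t}=-\tau\xi_{k+1}+A^*(z_{k+1}+y-Ax_{k+1}),\qquad \frac{z_{k+1}-z_k}{\Delta t}=y-Ax_{k+1},\qquad \xi_{k+1}\in\partial\|x_{k+1}\|_{l_1},$$ with the initial data $x_0=x$, $z_0=0$. Then, given any $\delta>0$, there exist $h>0$ and $T>0$ so that for all $0<\Delta t<h$ and all $k>[T/\Delta t]$ we have $|x_k-\bar x|<\delta$. The time $T$ depends on $\delta$, the initial data $x\in\mathbb{R}^n$, and the norm $\|AA^*\|$.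
   Context: $|\cdot|$ is the Euclidean norm on $\mathbb{R}^n$, $\|x\|_{l_1}=\sum_i|x_i|$, $A^*$ is the (conjugate) transpose of $A$, $\|AA^*\|$ is the operator norm, and $[\cdot]$ is the integer part. For $x\in\mathbb{R}^n$ the sub-differential is the set $\partial\|x\|_{l_1}=\mathrm{sgn}(x_1)\times\dots\times\mathrm{sgn}(x_n)\subset\mathbb{R}^n$, where for $s\in\mathbb{R}$ the set $\mathrm{sgn}(s)$ is $\{1\}$ if $s>0$, $\{-1\}$ if $s<0$, and $[-1,1]$ if $s=0$.
   Formalization: The time T is chosen for fixed A, y and τ and may depend on all of them, not only on δ, x and ‖AA*‖; a T depending on those three alone is impossible, since with A = (4/5, 3/5), x = 0, τ = 1 the time needed grows without bound as y grows. *)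

theory Defs
  imports "HOL-Analysis.Analysis"
begin

definition l1_norm :: "real ^ 'n \<Rightarrow> real" where
  "l1_norm x = (\<Sum>i\<in>UNIV. \<bar>x $ i\<bar>)"

text \<open>Set-valued sign; not to be confused with the single-valued library function \<open>sgn\<close>.\<close>
definition sgn_set :: "real \<Rightarrow> real set" where
  "sgn_set s = (if s > 0 then {1} else if s < 0 then {- 1} else {- 1..1})"

definition l1_subdifferential :: "real ^ 'n \<Rightarrow> (real ^ 'n) set" where
  "l1_subdifferential x = {\<xi>. \<forall>i. \<xi> $ i \<in> sgn_set (x $ i)}"

definition unique_l1_minimizer ::
    "real ^ 'n ^ 'm \<Rightarrow> real ^ 'm \<Rightarrow> real ^ 'n \<Rightarrow> bool" where
  "unique_l1_minimizer A y xbar \<longleftrightarrow>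
     (\<forall>x. is_arg_min l1_norm (\<lambda>x. A *v x = y) x \<longleftrightarrow> x = xbar)"

definition implicit_scheme ::
    "real ^ 'n ^ 'm \<Rightarrow> real ^ 'm \<Rightarrow> real \<Rightarrow> real \<Rightarrow>
     (nat \<Rightarrow> real ^ 'n) \<Rightarrow> (nat \<Rightarrow> real ^ 'm) \<Rightarrow> (nat \<Rightarrow> real ^ 'n) \<Rightarrow> bool" where
  "implicit_scheme A y \<tau> dt xs zs \<xi> \<longleftrightarrow>
     (\<forall>k. (xs (Suc k) - xs k) /\<^sub>R dt
            = - (\<tau> *\<^sub>R \<xi> (Suc k)) + transpose A *v (zs (Suc k) + y - A *v xs (Suc k))
        \<and> (zs (Suc k) - zs k) /\<^sub>R dt = y - A *v xs (Suc k)
        \<and> \<xi> (Suc k) \<in> l1_subdifferential (xs (Suc k)))"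

end

theory Submission
  imports Defs
begin

text \<open>
  For every dual certificate \<open>q\<close>, the squared distance of \<open>(x\<^sub>k, z\<^sub>k)\<close> to \<open>(xbar, q)\<close> is nonincreasing,
  and its decrease controls the defect in the optimality conditions. The difficulty is that \<open>z\<^sub>k\<close>
  need not approach a prescribed \<open>q\<close>. However, among sufficiently many time windows of a fixed long
  length, one has a small total energy drop. Dividing the scheme, summed over that window, by
  its length shows that the averaged subgradient and some pair \<open>(x\<^sub>j, z\<^sub>j)\<close> of the window nearly
  satisfy the optimality conditions, all bounds being uniform in the step size. By compactness
  \<open>(x\<^sub>j, z\<^sub>j)\<close> is then close to \<open>(xbar, q')\<close> for some certificate \<open>q'\<close>, and monotonicity of the distance
  to this new point keeps \<open>x\<^sub>k\<close> close to \<open>xbar\<close> for all later \<open>k\<close>.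
\<close>

section \<open>The l1 norm and its subdifferential\<close>

lemma inner_le_l1_norm:
  assumes "\<And>i. \<bar>\<xi> $ i\<bar> \<le> 1"
  shows "\<xi> \<bullet> x \<le> l1_norm x"
  unfolding l1_norm_def inner_vec_def
proof (rule sum_mono)
  fix i
  have "\<xi> $ i \<bullet> x $ i \<le> \<bar>\<xi> $ i\<bar> * \<bar>x $ i\<bar>"
    by (simp flip: abs_mult)
  also have "\<dots> \<le> 1 * \<bar>x $ i\<bar>"
    by (intro mult_right_mono assms) simp
  finally show "\<xi> $ i \<bullet> x $ i \<le> \<bar>x $ i\<bar>"
    by simp
qed

lemma l1_subdifferential_inner:
  assumes "\<xi> \<in> l1_subdifferential x"
  shows "\<xi> \<bullet> x = l1_norm x"
  unfolding l1_norm_def inner_vec_def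
proof (rule sum.cong)
  fix i
  have "\<xi> $ i \<in> sgn_set (x $ i)"
    using assms by (auto simp: l1_subdifferential_def)
  then show "\<xi> $ i \<bullet> x $ i = \<bar>x $ i\<bar>"
    by (cases "x $ i = 0") (auto simp: sgn_set_def split: if_splits)
qed simp

lemma l1_subdifferential_abs_le:
  assumes "\<xi> \<in> l1_subdifferential x"
  shows "\<bar>\<xi> $ i\<bar> \<le> 1"
proof -
  have "\<xi> $ i \<in> sgn_set (x $ i)"
    using assms by (auto simp: l1_subdifferential_def)
  then show ?thesis
    by (auto simp: sgn_set_def split: if_splits)
qed

lemma inner_transpose_matrix_vector:
  fixes A :: "real ^ 'n ^ 'm"
  shows "(transpose A *v w) \<bullet> e = w \<bullet> (A *v e)"
  by (simp add: dot_lmul_matrix)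

text \<open>Being a box makes the subdifferential compact and convex at once, which is what the
  separation argument for certificates requires.\<close>

lemma l1_subdifferential_eq_cbox:
  "l1_subdifferential x =
     cbox (\<chi> i. if x $ i > 0 then 1 else - 1) (\<chi> i. if x $ i < 0 then - 1 else 1)"
proof -
  have "sgn_set s = {(if s > 0 then 1 else - 1)..(if s < 0 then - 1 else 1)}" for s :: real
    by (auto simp: sgn_set_def)
  then show ?thesis
    unfolding l1_subdifferential_def set_eq_iff mem_box_cart mem_Collect_eq vec_lambda_beta
    by (simp only: atLeastAtMost_iff simp_thms)
qed

text \<open>Along a short enough segment no nonzero coordinate of \<open>x\<close> changes sign, so
  the norm is affine there. Its slope is attained by the subgradient that follows the sign of
  \<open>d\<close> wherever \<open>x\<close> vanishes.\<close>

lemma l1_norm_directional_derivative: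
  fixes x d :: "real ^ 'n"
  obtains g t where "g \<in> l1_subdifferential x" "t > 0"
    "l1_norm (x + t *\<^sub>R d) = l1_norm x + t * (g \<bullet> d)"
proof -
  define g :: "real ^ 'n" where "g = (\<chi> i. if x $ i = 0 then sgn (d $ i) else sgn (x $ i))"
  \<comment> \<open>The element 1 keeps the minimum meaningful when \<open>x = 0\<close>, and
    \<open>1 +\<close> in the denominators avoids division by zero where \<open>d\<close>
    vanishes.\<close>
  define S where "S = insert 1 ((\<lambda>i. \<bar>x $ i\<bar> / (1 + \<bar>d $ i\<bar>)) ` {i. x $ i \<noteq> 0})"
  define t where "t = Min S"
  have fin: "finite S" "S \<noteq> {}"
    by (auto simp: S_def)
  have "t \<in> S"
    unfolding t_def using fin by (rule Min_in)
  then have t0: "t > 0"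
    by (auto simp: S_def intro!: divide_pos_pos add_pos_nonneg)
  have td: "t * \<bar>d $ i\<bar> \<le> \<bar>x $ i\<bar>" if "x $ i \<noteq> 0" for i
  proof -
    have "t \<le> \<bar>x $ i\<bar> / (1 + \<bar>d $ i\<bar>)"
      unfolding t_def using fin that by (intro Min_le) (auto simp: S_def)
    then have "t * (1 + \<bar>d $ i\<bar>) \<le> \<bar>x $ i\<bar>"
      by (simp add: pos_le_divide_eq add_pos_nonneg)
    then show ?thesis
      using t0 by (simp add: algebra_simps)
  qed
  have "g \<in> l1_subdifferential x"
    by (auto simp: g_def l1_subdifferential_def sgn_set_def sgn_if)
  moreover have "l1_norm (x + t *\<^sub>R d) = l1_norm x + t * (g \<bullet> d)"
  proof -
    have "\<bar>x $ i + t * d $ i\<bar> = \<bar>x $ i\<bar> + t * (g $ i * d $ i)" for i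
    proof (cases "x $ i = 0")
      case True
      then show ?thesis
        using t0 by (simp add: g_def abs_mult sgn_if)
    next
      case False
      have "\<bar>t * d $ i\<bar> \<le> \<bar>x $ i\<bar>"
        using td[OF False] t0 by (simp add: abs_mult)
      then show ?thesis
        using False by (auto simp: g_def sgn_if abs_if split: if_splits)
    qed
    then show ?thesis
      by (simp add: l1_norm_def inner_vec_def sum.distrib sum_distrib_left)
  qed
  ultimately show ?thesis
    using that t0 by blast
qed

section \<open>Dual certificates of the minimizer\<close>

text \<open>The last two conditions say that \<open>\<Xi>\<close> is a subgradient at \<open>xbar\<close>, in a form stable under limits.\<close>
definition dual_certificate ::
    "real ^ 'n ^ 'm \<Rightarrow> real \<Rightarrow> real ^ 'n \<Rightarrow> real ^ 'm \<Rightarrow> real ^ 'n \<Rightarrow> bool" where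
  "dual_certificate A \<tau> xbar q \<Xi> \<longleftrightarrow>
     transpose A *v q = \<tau> *\<^sub>R \<Xi> \<and> (\<forall>i. \<bar>\<Xi> $ i\<bar> \<le> 1) \<and> \<Xi> \<bullet> xbar = l1_norm xbar"

lemma unique_l1_minimizerD:
  assumes "unique_l1_minimizer A y xbar"
  shows "A *v xbar = y"
    and "A *v x = y \<Longrightarrow> l1_norm xbar \<le> l1_norm x"
    and "A *v x = y \<Longrightarrow> l1_norm x \<le> l1_norm xbar \<Longrightarrow> x = xbar"
proof -
  have m: "is_arg_min l1_norm (\<lambda>x. A *v x = y) x \<longleftrightarrow> x = xbar" for x
    using assms by (auto simp: unique_l1_minimizer_def)
  show 1: "A *v xbar = y"
    using m[of xbar] by (auto simp: is_arg_min_def)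
  show 2: "l1_norm xbar \<le> l1_norm x" if "A *v x = y" for x
    using m[of xbar] that by (auto simp: is_arg_min_def not_less)
  show "x = xbar" if "A *v x = y" "l1_norm x \<le> l1_norm xbar"
  proof -
    have "is_arg_min l1_norm (\<lambda>x. A *v x = y) x"
      using that 2 by (force simp: is_arg_min_def)
    then show ?thesis
      using m by blast
  qed
qed

text \<open>If the subdifferential at \<open>xbar\<close> missed the range of the transpose, a
  hyperplane would separate the compact convex set from the subspace. Its normal \<open>d\<close>
  lies in the kernel of \<open>A\<close> and is a strict descent direction of the norm,
  contradicting minimality. Scaling by \<open>\<tau>\<close> then gives the certificate.\<close>

lemma dual_certificate_exists:
  fixes A :: "real ^ 'n ^ 'm"
  assumes "\<tau> > 0" "unique_l1_minimizer A y xbar"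
  obtains q \<Xi> where "dual_certificate A \<tau> xbar q \<Xi>"
proof -
  let ?G = "l1_subdifferential xbar" and ?R = "range ((*v) (transpose A))"
  have sub: "subspace ?R"
    by (intro linear_subspace_image) simp_all
  have "?G \<inter> ?R \<noteq> {}"
  proof
    assume disj: "?G \<inter> ?R = {}"
    \<comment> \<open>The direction 0 is chosen only to obtain some element of the
      subdifferential.\<close>
    obtain g0 t0 where "g0 \<in> ?G"
      by (rule l1_norm_directional_derivative[of xbar 0])
    then have "?G \<noteq> {}"
      by blast
    moreover have "compact ?G" "convex ?G"
      by (simp_all add: l1_subdifferential_eq_cbox)
    ultimately obtain d b where d: "\<forall>g\<in>?G. d \<bullet> g < b" "\<forall>r\<in>?R. d \<bullet> r > b"
      using separating_hyperplane_compact_closed[of ?G ?R] disj sub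
      by (auto simp: closed_subspace subspace_imp_convex)
    have b0: "b < 0"
      using d(2)[rule_format, OF subspace_0[OF sub]] by simp
    have Ad: "A *v d = 0"
    proof (rule ccontr)
      let ?v = "A *v d"
      assume "?v \<noteq> 0"
      then have v: "?v \<bullet> ?v > 0"
        by simp
      \<comment> \<open>The scaling is chosen so that this element of the range has inner product
        exactly \<open>b\<close> with \<open>d\<close>, against the strict bound.\<close>
      have "d \<bullet> (transpose A *v ((b / (?v \<bullet> ?v)) *\<^sub>R ?v)) > b"
        using d(2) by blast
      then have "((b / (?v \<bullet> ?v)) *\<^sub>R ?v) \<bullet> ?v > b"
        by (metis inner_commute inner_transpose_matrix_vector)
      then show False
        using v by simp
    qed
    obtain g t where g: "g \<in> ?G" "t > 0"
        "l1_norm (xbar + t *\<^sub>R d) = l1_norm xbar + t * (g \<bullet> d)"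
      by (rule l1_norm_directional_derivative)
    have "g \<bullet> d < 0"
      using d(1) g(1) b0 by (force simp: inner_commute)
    then have "l1_norm (xbar + t *\<^sub>R d) < l1_norm xbar"
      using g by (simp add: mult_pos_neg)
    moreover have "A *v (xbar + t *\<^sub>R d) = y"
      using Ad unique_l1_minimizerD(1)[OF assms(2)]
      by (simp add: matrix_vector_right_distrib matrix_vector_mult_scaleR)
    ultimately show False
      using unique_l1_minimizerD(2)[OF assms(2), of "xbar + t *\<^sub>R d"] by linarith
  qed
  then obtain q where q: "transpose A *v q \<in> ?G"
    by blast
  have "dual_certificate A \<tau> xbar (\<tau> *\<^sub>R q) (transpose A *v q)"
    unfolding dual_certificate_def
    using l1_subdifferential_inner[OF q] l1_subdifferential_abs_le[OF q]
    by (simp add: matrix_vector_mult_scaleR)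
  then show ?thesis
    by (rule that)
qed

section \<open>Measuring optimality, and compactness\<close>

text \<open>For a certificate, \<open>\<Xi> \<bullet> xbar = l1_norm xbar\<close>, so the first term
  is \<open>\<tau>\<close> times the Bregman distance of the l1 norm from \<open>xbar\<close> to
  \<open>p\<close>.\<close>

definition optimality_gap ::
    "real ^ 'n ^ 'm \<Rightarrow> real \<Rightarrow> real ^ 'n \<Rightarrow> real ^ 'n \<Rightarrow> real ^ 'n \<Rightarrow> real" where
  "optimality_gap A \<tau> xbar \<Xi> p = \<tau> * (l1_norm p - \<Xi> \<bullet> p) + (norm (A *v (p - xbar)))\<^sup>2"

text \<open>When the entries of \<open>\<Xi>\<close> are bounded by 1, both terms are nonnegative
  and the sum vanishes exactly for certificates.\<close>

definition certificate_residual ::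
    "real ^ 'n ^ 'm \<Rightarrow> real \<Rightarrow> real ^ 'n \<Rightarrow> real ^ 'm \<Rightarrow> real ^ 'n \<Rightarrow> real" where
  "certificate_residual A \<tau> xbar q \<Xi> =
     (l1_norm xbar - \<Xi> \<bullet> xbar) + norm (transpose A *v q - \<tau> *\<^sub>R \<Xi>)"

text \<open>Both nonnegative terms vanish, so \<open>p\<close> is feasible and
  \<open>l1_norm p = \<Xi> \<bullet> p\<close>. As \<open>\<tau> *\<^sub>R \<Xi>\<close> lies in the
  range of the transpose, \<open>\<Xi>\<close> takes the same value on \<open>p\<close> and
  \<open>xbar\<close>; thus \<open>p\<close> is a minimizer, and uniqueness applies.\<close>

lemma optimality_gap_eq_0D:
  fixes A :: "real ^ 'n ^ 'm"
  assumes "\<tau> > 0" "unique_l1_minimizer A y xbar" "dual_certificate A \<tau> xbar q \<Xi>"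
    and "optimality_gap A \<tau> xbar \<Xi> p \<le> 0"
  shows "p = xbar"
proof -
  have cert: "transpose A *v q = \<tau> *\<^sub>R \<Xi>" "\<And>i. \<bar>\<Xi> $ i\<bar> \<le> 1" "\<Xi> \<bullet> xbar = l1_norm xbar"
    using assms(3) by (auto simp: dual_certificate_def)
  have "\<tau> * (l1_norm p - \<Xi> \<bullet> p) \<ge> 0"
    using inner_le_l1_norm[OF cert(2), of p] assms(1) by simp
  moreover have "\<tau> * (l1_norm p - \<Xi> \<bullet> p) + (norm (A *v (p - xbar)))\<^sup>2 \<le> 0"
    using assms(4) by (simp add: optimality_gap_def)
  ultimately have "\<tau> * (l1_norm p - \<Xi> \<bullet> p) = 0" "(norm (A *v (p - xbar)))\<^sup>2 = 0"
    using zero_le_power2[of "norm (A *v (p - xbar))"] by linarith+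
  then have p: "l1_norm p = \<Xi> \<bullet> p" "A *v (p - xbar) = 0"
    using assms(1) by simp_all
  have "\<tau> * (\<Xi> \<bullet> (p - xbar)) = (transpose A *v q) \<bullet> (p - xbar)"
    by (simp only: cert(1) inner_scaleR_left)
  also have "\<dots> = 0"
    by (simp only: inner_transpose_matrix_vector p(2) inner_zero_right)
  finally have "\<Xi> \<bullet> p = \<Xi> \<bullet> xbar"
    using assms(1) by (simp add: inner_diff_right)
  then have "l1_norm p \<le> l1_norm xbar"
    using p cert(3) by simp
  moreover have "A *v p = y"
    using p(2) unique_l1_minimizerD(1)[OF assms(2)] by (simp add: matrix_vector_mult_diff_distrib)
  ultimately show ?thesis
    using unique_l1_minimizerD(3)[OF assms(2)] by blast
qed

text \<open>The total defect is continuous and strictly positive on a compact set from which a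
  neighbourhood of the optimal pairs is removed, so it has a positive minimum there. This
  \<open>\<eta>\<close> involves no step size.\<close>

lemma residual_small_imp_near_optimal:
  fixes A :: "real ^ 'n ^ 'm"
  assumes \<tau>: "\<tau> > 0" and uniq: "unique_l1_minimizer A y xbar"
    and cert: "dual_certificate A \<tau> xbar q0 \<Xi>0" and "\<delta> > 0"
  obtains \<eta> where "\<eta> > 0"
    "\<And>p q \<Xi>. \<lbrakk>norm (p - xbar) \<le> R; norm (q - q0) \<le> R; \<And>i. \<bar>\<Xi> $ i\<bar> \<le> 1;
        optimality_gap A \<tau> xbar \<Xi>0 p + certificate_residual A \<tau> xbar q \<Xi> < \<eta>\<rbrakk>
      \<Longrightarrow> \<exists>q' \<Xi>'. dual_certificate A \<tau> xbar q' \<Xi>' \<and>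
            (norm (p - xbar))\<^sup>2 + (norm (q - q'))\<^sup>2 < \<delta>\<^sup>2"
proof -
  define F where "F = (\<lambda>(p, q, \<Xi>).
    optimality_gap A \<tau> xbar \<Xi>0 p + certificate_residual A \<tau> xbar q \<Xi>)"
  \<comment> \<open>\<open>U\<close> restricts only \<open>p\<close> and \<open>q\<close>; the
    subgradient component is free. As a union of open sets it is open without any information on the
    set of certificates.\<close>
  define U :: "((real ^ 'n) \<times> (real ^ 'm) \<times> (real ^ 'n)) set" where
    "U = (\<Union>q'\<in>{q'. \<exists>\<Xi>'. dual_certificate A \<tau> xbar q' \<Xi>'}.
       {u. (norm (fst u - xbar))\<^sup>2 + (norm (fst (snd u) - q'))\<^sup>2 < \<delta>\<^sup>2})"
  define K :: "((real ^ 'n) \<times> (real ^ 'm) \<times> (real ^ 'n)) set" where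
    "K = cball xbar R \<times> cball q0 R \<times> cbox (\<chi> i. - 1) (\<chi> i. 1)"
  have inK: "(p, q, \<Xi>) \<in> K \<longleftrightarrow>
      norm (p - xbar) \<le> R \<and> norm (q - q0) \<le> R \<and> (\<forall>i. \<bar>\<Xi> $ i\<bar> \<le> 1)" for p q \<Xi>
    by (auto simp: K_def dist_norm norm_minus_commute mem_box_cart abs_le_iff)
  have "open U"
    unfolding U_def by (intro open_UN ballI open_Collect_less continuous_intros)
  moreover have "compact K"
    unfolding K_def by (intro compact_Times compact_cball compact_cbox)
  ultimately have cpt: "compact (K - U)"
    by (rule compact_diff[rotated])
  have "continuous_on (K - U) F"
    unfolding F_def optimality_gap_def certificate_residual_def l1_norm_def case_prod_unfold
    by (intro continuous_intros bounded_linear.continuous_on[OF matrix_vector_mul_bounded_linear])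
  \<comment> \<open>A point of \<open>K\<close> with nonpositive defect has \<open>p = xbar\<close>
    and a \<open>q\<close> that is itself a certificate, so it is at distance 0 from an optimal pair
    and lies in \<open>U\<close>.\<close>
  have pos: "F u > 0" if u: "u \<in> K - U" for u
  proof (rule ccontr)
    obtain p q \<Xi> where upq: "u = (p, q, \<Xi>)"
      by (cases u)
    have \<Xi>: "\<And>i. \<bar>\<Xi> $ i\<bar> \<le> 1"
      using u by (auto simp: upq inK)
    assume "\<not> F u > 0"
    then have "optimality_gap A \<tau> xbar \<Xi>0 p + (l1_norm xbar - \<Xi> \<bullet> xbar)
        + norm (transpose A *v q - \<tau> *\<^sub>R \<Xi>) \<le> 0"
      by (simp add: F_def upq certificate_residual_def)
    moreover have "optimality_gap A \<tau> xbar \<Xi>0 p \<ge> 0"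
      unfolding optimality_gap_def using \<tau> cert inner_le_l1_norm[of \<Xi>0 p]
      by (simp add: dual_certificate_def)
    moreover have "l1_norm xbar - \<Xi> \<bullet> xbar \<ge> 0"
      using inner_le_l1_norm[OF \<Xi>, of xbar] by simp
    ultimately have "optimality_gap A \<tau> xbar \<Xi>0 p \<le> 0" "l1_norm xbar - \<Xi> \<bullet> xbar = 0"
        "norm (transpose A *v q - \<tau> *\<^sub>R \<Xi>) = 0"
      using norm_ge_zero[of "transpose A *v q - \<tau> *\<^sub>R \<Xi>"] by linarith+
    then have "p = xbar" "dual_certificate A \<tau> xbar q \<Xi>"
      using optimality_gap_eq_0D[OF \<tau> uniq cert] \<Xi> by (auto simp: dual_certificate_def)
    then have "u \<in> U"
      using \<open>\<delta> > 0\<close> by (auto simp: U_def upq)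
    then show False
      using u by blast
  qed
  obtain \<eta> where \<eta>: "\<eta> > 0" "\<And>u. u \<in> K - U \<Longrightarrow> \<eta> \<le> F u"
  proof (cases "K - U = {}")
    case True
    then show ?thesis
      using that[of 1] by auto
  next
    case False
    then obtain u where "u \<in> K - U" "\<forall>v\<in>K - U. F u \<le> F v"
      using continuous_attains_inf[OF cpt _ \<open>continuous_on (K - U) F\<close>] by blast
    then show ?thesis
      using that[of "F u"] pos by auto
  qed
  show ?thesis
  proof (rule that[OF \<eta>(1)])
    fix p q \<Xi>
    assume "norm (p - xbar) \<le> R" "norm (q - q0) \<le> R" "\<And>i. \<bar>\<Xi> $ i\<bar> \<le> 1"
      and "optimality_gap A \<tau> xbar \<Xi>0 p + certificate_residual A \<tau> xbar q \<Xi> < \<eta>"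
    then have "(p, q, \<Xi>) \<in> K" "F (p, q, \<Xi>) < \<eta>"
      by (simp_all add: inK F_def)
    then have "(p, q, \<Xi>) \<in> U"
      using \<eta>(2)[of "(p, q, \<Xi>)"] by force
    then show "\<exists>q' \<Xi>'. dual_certificate A \<tau> xbar q' \<Xi>' \<and>
        (norm (p - xbar))\<^sup>2 + (norm (q - q'))\<^sup>2 < \<delta>\<^sup>2"
      by (auto simp: U_def)
  qed
qed


section \<open>Energy dissipation along the scheme\<close>

definition scheme_energy :: "real ^ 'n \<Rightarrow> real ^ 'm \<Rightarrow> real ^ 'n \<Rightarrow> real ^ 'm \<Rightarrow> real" where
  "scheme_energy xbar q x z = (norm (x - xbar))\<^sup>2 + (norm (z - q))\<^sup>2"

lemma scheme_energy_nonneg: "scheme_energy xbar q x z \<ge> 0"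
  by (simp add: scheme_energy_def)

text \<open>For \<open>\<xi>\<close> a subgradient at \<open>x\<close> and \<open>\<Xi>\<close> from
  a certificate this equals \<open>\<tau> * ((\<xi> - \<Xi>) \<bullet> (x - xbar))\<close> plus the
  squared residual. In the expanded form each nonnegative summand can be bounded separately.\<close>

definition scheme_dissipation ::
    "real ^ 'n ^ 'm \<Rightarrow> real \<Rightarrow> real ^ 'n \<Rightarrow> real ^ 'n \<Rightarrow> real ^ 'n \<Rightarrow> real ^ 'n \<Rightarrow> real" where
  "scheme_dissipation A \<tau> xbar \<Xi> x \<xi> =
     optimality_gap A \<tau> xbar \<Xi> x + \<tau> * (l1_norm xbar - \<xi> \<bullet> xbar)"

lemma optimality_gap_ge:
  assumes "\<tau> > 0" "dual_certificate A \<tau> xbar q \<Xi>"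
  shows "optimality_gap A \<tau> xbar \<Xi> p \<ge> (norm (A *v (p - xbar)))\<^sup>2"
  unfolding optimality_gap_def using assms inner_le_l1_norm[of \<Xi> p]
  by (simp add: dual_certificate_def)

lemma implicit_schemeD:
  assumes "implicit_scheme A y \<tau> dt xs zs \<xi>" "dt > 0"
  shows "xs (Suc k) - xs k =
      dt *\<^sub>R (transpose A *v (zs (Suc k) + y - A *v xs (Suc k)) - \<tau> *\<^sub>R \<xi> (Suc k))"
    and "zs (Suc k) - zs k = dt *\<^sub>R (y - A *v xs (Suc k))"
    and "\<xi> (Suc k) \<in> l1_subdifferential (xs (Suc k))"
proof -
  have "(xs (Suc k) - xs k) /\<^sub>R dt =
      - (\<tau> *\<^sub>R \<xi> (Suc k)) + transpose A *v (zs (Suc k) + y - A *v xs (Suc k))"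
    and "(zs (Suc k) - zs k) /\<^sub>R dt = y - A *v xs (Suc k)"
    using assms(1) unfolding implicit_scheme_def by blast+
  then have "dt *\<^sub>R ((xs (Suc k) - xs k) /\<^sub>R dt) = dt *\<^sub>R
      (- (\<tau> *\<^sub>R \<xi> (Suc k)) + transpose A *v (zs (Suc k) + y - A *v xs (Suc k)))"
    and "dt *\<^sub>R ((zs (Suc k) - zs k) /\<^sub>R dt) = dt *\<^sub>R (y - A *v xs (Suc k))"
    by (simp_all only:)
  then show "xs (Suc k) - xs k =
      dt *\<^sub>R (transpose A *v (zs (Suc k) + y - A *v xs (Suc k)) - \<tau> *\<^sub>R \<xi> (Suc k))"
    "zs (Suc k) - zs k = dt *\<^sub>R (y - A *v xs (Suc k))"
    using assms(2) by (simp_all del: transpose_matrix_vector)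
  show "\<xi> (Suc k) \<in> l1_subdifferential (xs (Suc k))"
    using assms(1) unfolding implicit_scheme_def by blast
qed

text \<open>Pairing the increments with the new errors \<open>e\<close> and \<open>w\<close> cancels
  the coupling terms between \<open>w\<close> and \<open>A *v e\<close>, leaving the dissipation.
  Evaluation at the new time gives the squared increments a favourable sign, so no bound on
  \<open>dt\<close> is required.\<close>

lemma scheme_energy_step:
  fixes A :: "real ^ 'n ^ 'm"
  assumes sch: "implicit_scheme A y \<tau> dt xs zs \<xi>" and dt: "dt > 0" and y: "A *v xbar = y"
    and cert: "dual_certificate A \<tau> xbar q \<Xi>"
  shows "scheme_energy xbar q (xs (Suc k)) (zs (Suc k))
      + 2 * dt * scheme_dissipation A \<tau> xbar \<Xi> (xs (Suc k)) (\<xi> (Suc k))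
    \<le> scheme_energy xbar q (xs k) (zs k)"
proof -
  define e where "e = xs (Suc k) - xbar"
  define w where "w = zs (Suc k) - q"
  define \<zeta> where "\<zeta> = \<xi> (Suc k) - \<Xi>"
  have Ae: "y - A *v xs (Suc k) = - (A *v e)"
    by (simp add: e_def y[symmetric] matrix_vector_mult_diff_distrib)
  have dx: "xs (Suc k) - xs k =
      dt *\<^sub>R (transpose A *v w - transpose A *v (A *v e) - \<tau> *\<^sub>R \<zeta>)"
  proof -
    have "zs (Suc k) + y - A *v xs (Suc k) = w - A *v e + q"
      using Ae by (simp add: w_def algebra_simps)
    then have eq: "transpose A *v (zs (Suc k) + y - A *v xs (Suc k))
        = transpose A *v w - transpose A *v (A *v e) + \<tau> *\<^sub>R \<Xi>"
      using cert unfolding dual_certificate_def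
      by (simp only: matrix_vector_mult_diff_distrib matrix_vector_right_distrib)
    show ?thesis
      by (simp only: implicit_schemeD(1)[OF sch dt] eq) (simp add: \<zeta>_def algebra_simps)
  qed
  have dz: "zs (Suc k) - zs k = - (dt *\<^sub>R (A *v e))"
    by (simp only: implicit_schemeD(2)[OF sch dt] Ae scaleR_minus_right)
  have \<xi>: "\<xi> (Suc k) \<bullet> xs (Suc k) = l1_norm (xs (Suc k))"
    by (rule l1_subdifferential_inner[OF implicit_schemeD(3)[OF sch dt]])
  have "\<zeta> \<bullet> e = (l1_norm (xs (Suc k)) - \<Xi> \<bullet> xs (Suc k)) + (l1_norm xbar - \<xi> (Suc k) \<bullet> xbar)"
    using cert \<xi> by (simp add: \<zeta>_def e_def inner_diff dual_certificate_def)
  then have diss: "scheme_dissipation A \<tau> xbar \<Xi> (xs (Suc k)) (\<xi> (Suc k))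
      = \<tau> * (\<zeta> \<bullet> e) + (norm (A *v e))\<^sup>2"
    by (simp only: scheme_dissipation_def optimality_gap_def e_def distrib_left add_ac)
  \<comment> \<open>The difference of the two sides is the discarded square of the increment
    \<open>b\<close>.\<close>
  have sq: "(norm a)\<^sup>2 - (norm (a - b))\<^sup>2 \<le> 2 * (b \<bullet> a)" for a b :: "'a :: real_inner"
    using inner_ge_zero[of b] by (simp add: power2_norm_eq_inner inner_diff inner_commute)
  have "scheme_energy xbar q (xs (Suc k)) (zs (Suc k)) - scheme_energy xbar q (xs k) (zs k)
      = ((norm e)\<^sup>2 - (norm (e - (xs (Suc k) - xs k)))\<^sup>2)
        + ((norm w)\<^sup>2 - (norm (w - (zs (Suc k) - zs k)))\<^sup>2)"
    by (simp add: scheme_energy_def e_def w_def algebra_simps)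
  also have "\<dots> \<le> 2 * ((xs (Suc k) - xs k) \<bullet> e) + 2 * ((zs (Suc k) - zs k) \<bullet> w)"
    by (intro add_mono sq)
  also have "\<dots> = 2 * dt * (w \<bullet> (A *v e) - (A *v e) \<bullet> (A *v e) - \<tau> * (\<zeta> \<bullet> e))
      - 2 * dt * ((A *v e) \<bullet> w)"
    unfolding dx dz inner_scaleR_left inner_diff_left inner_transpose_matrix_vector inner_minus_left
    by simp
  also have "\<dots> = - (2 * dt * scheme_dissipation A \<tau> xbar \<Xi> (xs (Suc k)) (\<xi> (Suc k)))"
    unfolding diss power2_norm_eq_inner by (simp add: algebra_simps inner_commute)
  finally show ?thesis
    by simp
qed

lemma scheme_dissipation_ge:
  assumes "implicit_scheme A y \<tau> dt xs zs \<xi>" "dt > 0" "\<tau> > 0"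
    and "dual_certificate A \<tau> xbar q \<Xi>"
  shows "scheme_dissipation A \<tau> xbar \<Xi> (xs (Suc k)) (\<xi> (Suc k)) \<ge> optimality_gap A \<tau> xbar \<Xi> (xs (Suc k))"
    and "scheme_dissipation A \<tau> xbar \<Xi> (xs (Suc k)) (\<xi> (Suc k)) \<ge> \<tau> * (l1_norm xbar - \<xi> (Suc k) \<bullet> xbar)"
    and "scheme_dissipation A \<tau> xbar \<Xi> (xs (Suc k)) (\<xi> (Suc k)) \<ge> (norm (A *v (xs (Suc k) - xbar)))\<^sup>2"
    and "scheme_dissipation A \<tau> xbar \<Xi> (xs (Suc k)) (\<xi> (Suc k)) \<ge> 0"
proof -
  have "\<tau> * (l1_norm xbar - \<xi> (Suc k) \<bullet> xbar) \<ge> 0"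
    using inner_le_l1_norm[of "\<xi> (Suc k)" xbar] assms(3)
      l1_subdifferential_abs_le[OF implicit_schemeD(3)[OF assms(1,2)]] by simp
  moreover note optimality_gap_ge[OF assms(3,4), of "xs (Suc k)"]
    zero_le_power2[of "norm (A *v (xs (Suc k) - xbar))"]
  ultimately show "scheme_dissipation A \<tau> xbar \<Xi> (xs (Suc k)) (\<xi> (Suc k)) \<ge> optimality_gap A \<tau> xbar \<Xi> (xs (Suc k))"
    "scheme_dissipation A \<tau> xbar \<Xi> (xs (Suc k)) (\<xi> (Suc k)) \<ge> \<tau> * (l1_norm xbar - \<xi> (Suc k) \<bullet> xbar)"
    "scheme_dissipation A \<tau> xbar \<Xi> (xs (Suc k)) (\<xi> (Suc k)) \<ge> (norm (A *v (xs (Suc k) - xbar)))\<^sup>2"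
    "scheme_dissipation A \<tau> xbar \<Xi> (xs (Suc k)) (\<xi> (Suc k)) \<ge> 0"
    unfolding scheme_dissipation_def by linarith+
qed

lemma scheme_energy_sum:
  assumes "implicit_scheme A y \<tau> dt xs zs \<xi>" "dt > 0" "A *v xbar = y"
    and "dual_certificate A \<tau> xbar q \<Xi>"
  shows "scheme_energy xbar q (xs (k + N)) (zs (k + N))
      + 2 * dt * (\<Sum>i<N. scheme_dissipation A \<tau> xbar \<Xi> (xs (k + Suc i)) (\<xi> (k + Suc i)))
    \<le> scheme_energy xbar q (xs k) (zs k)"
proof (induction N)
  case (Suc N)
  then show ?case
    using scheme_energy_step[OF assms, of "k + N"] by (simp add: algebra_simps)
qed simp

text \<open>The certificate is arbitrary, so the reference point may be changed midway along the
  sequence.\<close>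

lemma scheme_energy_antimono:
  assumes "implicit_scheme A y \<tau> dt xs zs \<xi>" "dt > 0" "A *v xbar = y" "\<tau> > 0"
    and "dual_certificate A \<tau> xbar q \<Xi>" "j \<le> k"
  shows "scheme_energy xbar q (xs k) (zs k) \<le> scheme_energy xbar q (xs j) (zs j)"
proof -
  have "0 \<le> 2 * dt * (\<Sum>i<k - j. scheme_dissipation A \<tau> xbar \<Xi> (xs (j + Suc i)) (\<xi> (j + Suc i)))"
    using scheme_dissipation_ge(4)[OF assms(1,2,4,5)] assms(2)
    by (intro mult_nonneg_nonneg sum_nonneg) auto
  then show ?thesis
    using scheme_energy_sum[OF assms(1-3,5), of j "k - j"] \<open>j \<le> k\<close> by simp
qed

section \<open>Averaging over a time window\<close>

text \<open>The bound \<open>R\<close> controls a single difference quotient of \<open>xs\<close>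
  only by \<open>2 * R / dt\<close>. Summing over the window telescopes the increments and yields
  \<open>2 * R / (N * dt)\<close> instead, at the price of averaging the subgradients and of letting
  \<open>zs\<close> drift. The drift is at most the integrated residual, which Cauchy-Schwarz bounds
  by the dissipation.\<close>

lemma window_small_residual:
  fixes A :: "real ^ 'n ^ 'm"
  assumes sch: "implicit_scheme A y \<tau> dt xs zs \<xi>" and dt: "dt > 0" and y: "A *v xbar = y"
    and \<tau>: "\<tau> > 0" and cert: "dual_certificate A \<tau> xbar q \<Xi>"
    and R: "\<And>j. norm (xs j - xbar) \<le> R"
    and B: "B > 0" "\<And>v. norm (transpose A *v v) \<le> B * norm v"
    and s: "real N * dt \<ge> 1"
    and drop: "scheme_energy xbar q (xs k) (zs k)
      - scheme_energy xbar q (xs (k + N)) (zs (k + N)) \<le> \<theta>"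
  obtains i \<Xi>' where "i < N" "\<And>j. \<bar>\<Xi>' $ j\<bar> \<le> 1"
    "optimality_gap A \<tau> xbar \<Xi> (xs (k + Suc i)) + certificate_residual A \<tau> xbar (zs (k + Suc i)) \<Xi>'
      \<le> \<theta> + \<theta> / \<tau> + 2 * R / (N * dt) + 2 * B * sqrt (N * dt * \<theta>)"
proof -
  define s where "s = real N * dt"
  define D where "D = (\<lambda>i. scheme_dissipation A \<tau> xbar \<Xi> (xs (k + Suc i)) (\<xi> (k + Suc i)))"
  define a where "a = (\<lambda>i. norm (A *v (xs (k + Suc i) - xbar)))"
  define S where "S = (\<Sum>i<N. dt * a i)"
  define \<Xi>' where "\<Xi>' = (1 / real N) *\<^sub>R (\<Sum>i<N. \<xi> (k + Suc i))"
  have s1: "s \<ge> 1"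
    using s by (simp add: s_def)
  then have N: "N > 0"
    by (cases N) (simp_all add: s_def)
  have D: "D i \<ge> 0" "D i \<ge> optimality_gap A \<tau> xbar \<Xi> (xs (k + Suc i))"
      "D i \<ge> \<tau> * (l1_norm xbar - \<xi> (k + Suc i) \<bullet> xbar)" "D i \<ge> (a i)\<^sup>2" for i
    using scheme_dissipation_ge[OF sch dt \<tau> cert, of "k + i"] by (simp_all add: D_def a_def)
  have a0: "a i \<ge> 0" for i
    by (simp add: a_def)
  have "2 * (dt * sum D {..<N}) \<le> \<theta>"
    using scheme_energy_sum[OF sch dt y cert, of k N] drop by (simp add: D_def)
  moreover have D0: "dt * sum D {..<N} \<ge> 0"
    using dt D(1) by (intro mult_nonneg_nonneg sum_nonneg) auto
  ultimately have sumD: "dt * sum D {..<N} \<le> \<theta>"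
    by linarith
  then have \<theta>0: "\<theta> \<ge> 0"
    using D0 by linarith

  obtain i where i: "i < N" "D i \<le> \<theta>"
  proof -
    \<comment> \<open>If every \<open>D i\<close> exceeded \<open>\<theta>\<close>, the integrated
      dissipation would exceed \<open>N * dt * \<theta>\<close>, which is at least
      \<open>\<theta>\<close> since the window lasts at least one time unit.\<close>
    have "\<exists>i<N. D i \<le> \<theta>"
    proof (rule ccontr)
      assume "\<not> ?thesis"
      then have "(\<Sum>i<N. \<theta>) < sum D {..<N}"
        using N by (intro sum_strict_mono) (auto simp: not_le)
      then have "dt * (real N * \<theta>) < dt * sum D {..<N}"
        using dt by simp
      then have "dt * (real N * \<theta>) < \<theta>"
        using sumD by linarith
      moreover have "\<theta> \<le> s * \<theta>"
        using mult_right_mono[OF s1 \<theta>0] by simp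
      ultimately show False
        by (simp add: s_def mult_ac)
    qed
    then show ?thesis
      using that by blast
  qed

  have \<Xi>'1: "\<bar>\<Xi>' $ j\<bar> \<le> 1" for j
  proof -
    have "\<bar>\<Sum>i<N. \<xi> (k + Suc i) $ j\<bar> \<le> (\<Sum>i<N. 1)"
      using l1_subdifferential_abs_le[OF implicit_schemeD(3)[OF sch dt]]
      by (intro order_trans[OF sum_abs] sum_mono) simp
    then show ?thesis
      using N by (simp add: \<Xi>'_def abs_mult divide_simps)
  qed
  have \<Xi>'2: "l1_norm xbar - \<Xi>' \<bullet> xbar \<le> \<theta> / \<tau>"
  proof -
    have "s * \<tau> * (l1_norm xbar - \<Xi>' \<bullet> xbar)
        = dt * (\<Sum>i<N. \<tau> * (l1_norm xbar - \<xi> (k + Suc i) \<bullet> xbar))"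
      using N by (simp add: \<Xi>'_def s_def sum_subtractf inner_sum_left flip: sum_distrib_left)
        (simp add: field_simps)
    also have "\<dots> \<le> dt * sum D {..<N}"
      using D(3) dt by (intro mult_left_mono sum_mono) auto
    finally have "s * (\<tau> * (l1_norm xbar - \<Xi>' \<bullet> xbar)) \<le> \<theta>"
      using sumD by simp
    moreover have "\<tau> * (l1_norm xbar - \<Xi>' \<bullet> xbar) \<le> s * (\<tau> * (l1_norm xbar - \<Xi>' \<bullet> xbar))"
      using mult_right_mono[OF s1, of "\<tau> * (l1_norm xbar - \<Xi>' \<bullet> xbar)"]
        inner_le_l1_norm[OF \<Xi>'1, of xbar] \<tau> by simp
    ultimately have "\<tau> * (l1_norm xbar - \<Xi>' \<bullet> xbar) \<le> \<theta>"
      by (rule order_trans[rotated])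
    then show ?thesis
      using \<tau> by (simp add: pos_le_divide_eq mult.commute)
  qed

  have S0: "S \<ge> 0"
    unfolding S_def using dt a0 by (intro sum_nonneg) simp
  \<comment> \<open>Cauchy-Schwarz in time: the square of the integrated residual is at most the
    duration times the integrated dissipation.\<close>
  have S: "S \<le> sqrt (s * \<theta>)"
  proof (rule real_le_rsqrt)
    have "(sum a {..<N})\<^sup>2 \<le> (\<Sum>i<N. (a i)\<^sup>2) * card {..<N}"
      by (rule sum_squared_le_sum_of_squares)
    also have "\<dots> \<le> sum D {..<N} * real N"
      using D(4) by (simp add: mult_right_mono sum_mono)
    finally have "dt\<^sup>2 * (sum a {..<N})\<^sup>2 \<le> dt\<^sup>2 * (sum D {..<N} * real N)"
      by (rule mult_left_mono) simp
    also have "\<dots> = s * (dt * sum D {..<N})"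
      by (simp add: s_def power2_eq_square)
    also have "\<dots> \<le> s * \<theta>"
      using sumD s1 by (intro mult_left_mono) auto
    finally show "S\<^sup>2 \<le> s * \<theta>"
      by (simp add: S_def power_mult_distrib flip: sum_distrib_left)
  qed

  have res: "y - A *v xs (k + Suc l) = - (A *v (xs (k + Suc l) - xbar))" for l
    by (simp add: y[symmetric] matrix_vector_mult_diff_distrib)
  have dz: "norm (zs (k + Suc l) - zs (k + l)) = dt * a l" for l
    using implicit_schemeD(2)[OF sch dt, of "k + l"] res[of l] dt by (simp add: a_def)
  \<comment> \<open>\<open>S\<close> is the total path length of \<open>zs\<close> in the window.
    The increment with index \<open>l\<close> ends at time \<open>k + Suc l\<close>, so the sum
    starts at \<open>Suc m\<close>.\<close>
  have z_le: "norm (zs (k + Suc n) - zs (k + Suc m)) \<le> S" if "m \<le> n" "n < N" for m n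
  proof -
    have "zs (k + Suc n) - zs (k + Suc m) = (\<Sum>l=Suc m..<Suc n. zs (k + Suc l) - zs (k + l))"
      using sum_Suc_diff'[of "Suc m" "Suc n" "\<lambda>l. zs (k + l)"] that by simp
    also have "norm \<dots> \<le> (\<Sum>l=Suc m..<Suc n. dt * a l)"
      by (rule order_trans[OF norm_sum]) (simp only: dz order_refl)
    also have "\<dots> \<le> S"
      unfolding S_def using dt a0 that by (intro sum_mono2) auto
    finally show ?thesis .
  qed
  have z: "norm (zs (k + Suc i) - zs (k + Suc l)) \<le> S" if "l < N" for l
    using z_le[of i l] z_le[of l i] i(1) that by (metis nat_le_linear norm_minus_commute)

  have eq: "norm (transpose A *v zs (k + Suc i) - \<tau> *\<^sub>R \<Xi>') \<le> 2 * R / s + 2 * B * S"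
  proof -
    let ?T = "\<lambda>v. transpose A *v v"
    let ?u = "?T (zs (k + Suc i)) - \<tau> *\<^sub>R \<Xi>'"
    define c where "c = (\<lambda>l. zs (k + Suc i) - zs (k + Suc l) - (y - A *v xs (k + Suc l)))"
    have "xs (k + N) - xs k = (\<Sum>l<N. xs (k + Suc l) - xs (k + l))"
      using sum_lessThan_telescope[of "\<lambda>l. xs (k + l)" N] by simp
    also have "\<dots> = (\<Sum>l<N. dt *\<^sub>R (?T (zs (k + Suc l) + y - A *v xs (k + Suc l)) - \<tau> *\<^sub>R \<xi> (k + Suc l)))"
      using implicit_schemeD(1)[OF sch dt, of "k + l" for l] by (intro sum.cong) simp_all
    also have "\<dots> = (\<Sum>l<N. dt *\<^sub>R ?T (zs (k + Suc i)) - dt *\<^sub>R \<tau> *\<^sub>R \<xi> (k + Suc l) - dt *\<^sub>R ?T (c l))"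
      by (intro sum.cong refl)
        (simp add: c_def matrix_vector_mult_diff_distrib matrix_vector_right_distrib algebra_simps
          del: transpose_matrix_vector)
    also have "\<dots> = s *\<^sub>R ?u - (\<Sum>l<N. dt *\<^sub>R ?T (c l))"
      using N by (simp add: sum_subtractf s_def \<Xi>'_def scaleR_diff_right sum_constant_scaleR
          mult.commute del: transpose_matrix_vector sum_constant flip: scaleR_sum_right)
    finally have "s *\<^sub>R ?u = (xs (k + N) - xs k) + (\<Sum>l<N. dt *\<^sub>R ?T (c l))"
      by simp
    then have "norm (s *\<^sub>R ?u) \<le> norm (xs (k + N) - xs k) + norm (\<Sum>l<N. dt *\<^sub>R ?T (c l))"
      by (simp only: norm_triangle_ineq)
    moreover have "norm (xs (k + N) - xs k) \<le> 2 * R"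
      using R[of k] R[of "k + N"] norm_triangle_ineq4[of "xs (k + N) - xbar" "xs k - xbar"] by simp
    moreover have "norm (\<Sum>l<N. dt *\<^sub>R ?T (c l)) \<le> (\<Sum>l<N. dt * (B * (S + a l)))"
    proof (rule sum_norm_le)
      fix l
      assume "l \<in> {..<N}"
      have "norm (c l) \<le> norm (zs (k + Suc i) - zs (k + Suc l)) + norm (y - A *v xs (k + Suc l))"
        unfolding c_def by (rule norm_triangle_ineq4)
      also have "\<dots> \<le> S + a l"
        using z[of l] \<open>l \<in> {..<N}\<close> by (simp only: res norm_minus_cancel a_def lessThan_iff add_right_mono)
      finally have "norm (?T (c l)) \<le> B * (S + a l)"
        using B(2)[of "c l"] mult_left_mono[of "norm (c l)" "S + a l" B] B(1) by linarith
      then show "norm (dt *\<^sub>R ?T (c l)) \<le> dt * (B * (S + a l))"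
        using dt by (simp del: transpose_matrix_vector)
    qed
    moreover have "(\<Sum>l<N. dt * (B * (S + a l))) = s * (B * S) + B * S"
      by (simp add: S_def s_def distrib_left sum.distrib sum_distrib_left mult_ac)
    \<comment> \<open>The residuals contribute one \<open>B * S\<close> and the drift contributes
      \<open>s * (B * S)\<close>; enlarging the former by \<open>s\<close> merges them into the
      factor 2.\<close>
    moreover have "B * S \<le> s * (B * S)"
      using mult_right_mono[OF s1, of "B * S"] B(1) S0 by simp
    ultimately have "norm (s *\<^sub>R ?u) \<le> 2 * R + s * (2 * (B * S))"
      by linarith
    then have "s * norm ?u \<le> s * (2 * R / s + 2 * B * S)"
      using s1 by (simp add: distrib_left del: transpose_matrix_vector)
    then show ?thesis
      using s1 by (simp del: transpose_matrix_vector)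
  qed

  show ?thesis
  proof (rule that[OF i(1) \<Xi>'1])
    have "2 * B * S \<le> 2 * B * sqrt (s * \<theta>)"
      using S B(1) by simp
    then show "optimality_gap A \<tau> xbar \<Xi> (xs (k + Suc i)) + certificate_residual A \<tau> xbar (zs (k + Suc i)) \<Xi>'
        \<le> \<theta> + \<theta> / \<tau> + 2 * R / (N * dt) + 2 * B * sqrt (N * dt * \<theta>)"
      using D(2)[of i] i(2) \<Xi>'2 eq unfolding certificate_residual_def s_def[symmetric] by linarith
  qed
qed

section \<open>Choice of the convergence time\<close>

lemma exists_small_drop:
  fixes f :: "nat \<Rightarrow> real"
  assumes "P > 0" "f 0 - f P \<le> real P * \<theta>"
  obtains i where "i < P" "f i - f (Suc i) \<le> \<theta>"
proof -
  have "\<exists>i<P. f i - f (Suc i) \<le> \<theta>"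
  proof (rule ccontr)
    assume "\<not> ?thesis"
    then have "(\<Sum>i<P. \<theta>) < (\<Sum>i<P. f i - f (Suc i))"
      using assms(1) by (intro sum_strict_mono) (auto simp: not_le)
    then show False
      using assms(2) by (simp add: sum_lessThan_telescope')
  qed
  then show ?thesis
    using that by blast
qed

text \<open>The window duration, the admissible drop and the number of windows are fixed in this
  order from \<open>\<eta>\<close>, \<open>R\<close>, \<open>B\<close> and \<open>\<tau>\<close>,
  before any step size is given. This makes the time uniform in \<open>dt\<close>.\<close>

lemma uniform_convergence_time:
  fixes A :: "real ^ 'n ^ 'm"
  assumes \<tau>: "\<tau> > 0" and uniq: "unique_l1_minimizer A y xbar"
    and cert: "dual_certificate A \<tau> xbar q \<Xi>" and \<delta>: "\<delta> > 0" and R: "R \<ge> 0"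
  obtains T where "T > 0"
    "\<And>dt xs zs \<xi> k. \<lbrakk>0 < dt; dt < 1; implicit_scheme A y \<tau> dt xs zs \<xi>;
        scheme_energy xbar q (xs 0) (zs 0) \<le> R\<^sup>2; real k > T / dt\<rbrakk> \<Longrightarrow> norm (xs k - xbar) < \<delta>"
proof -
  obtain \<eta> where \<eta>: "\<eta> > 0"
    "\<And>p q' \<Xi>'. \<lbrakk>norm (p - xbar) \<le> R; norm (q' - q) \<le> R; \<And>i. \<bar>\<Xi>' $ i\<bar> \<le> 1;
        optimality_gap A \<tau> xbar \<Xi> p + certificate_residual A \<tau> xbar q' \<Xi>' < \<eta>\<rbrakk>
      \<Longrightarrow> \<exists>q'' \<Xi>''. dual_certificate A \<tau> xbar q'' \<Xi>'' \<and>
            (norm (p - xbar))\<^sup>2 + (norm (q' - q''))\<^sup>2 < \<delta>\<^sup>2"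
    using residual_small_imp_near_optimal[OF \<tau> uniq cert \<delta>, of R] by blast
  obtain B where B: "B > 0" "\<And>v. norm (transpose A *v v) \<le> B * norm v"
    using bounded_linear.pos_bounded[OF matrix_vector_mul_bounded_linear[of "transpose A"]]
    by (metis mult.commute)
  \<comment> \<open>Each of the three error contributions gets a budget of
    \<open>\<eta> / 4\<close>. \<open>L\<close> handles the telescoped term, and the two entries of
    the minimum \<open>\<theta>\<close> handle the linear and square root terms for windows of
    duration up to \<open>L + 1\<close>.\<close>
  define L where "L = max 1 (8 * R / \<eta>)"
  define \<theta> where "\<theta> = min (\<eta> / (4 * (1 + 1 / \<tau>))) ((\<eta> / (8 * B))\<^sup>2 / (L + 1))"
  \<comment> \<open>The energy starts at no more than \<open>R\<^sup>2\<close>, so among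
    \<open>P\<close> consecutive windows one has a drop of at most \<open>\<theta>\<close>.\<close>
  define P where "P = Suc (nat \<lceil>R\<^sup>2 / \<theta>\<rceil>)"
  have L: "L \<ge> 1" "8 * R / \<eta> \<le> L"
    by (simp_all add: L_def)
  have \<theta>: "\<theta> > 0"
    using \<eta>(1) \<tau> B L(1) by (simp add: \<theta>_def add_pos_pos)
  have \<theta>1: "\<theta> + \<theta> / \<tau> \<le> \<eta> / 4"
  proof -
    have "1 + 1 / \<tau> \<noteq> 0"
      using \<tau> by (simp add: add_pos_pos less_imp_neq[symmetric])
    have "\<theta> * (1 + 1 / \<tau>) \<le> \<eta> / (4 * (1 + 1 / \<tau>)) * (1 + 1 / \<tau>)"
      using \<tau> by (intro mult_right_mono) (auto simp: \<theta>_def)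
    also have "\<dots> = \<eta> / 4"
      using mult_divide_mult_cancel_right[OF \<open>1 + 1 / \<tau> \<noteq> 0\<close>, of \<eta> 4]
      by (simp only: times_divide_eq_left)
    finally show ?thesis
      by (simp add: distrib_left)
  qed
  have \<theta>2: "2 * B * sqrt ((L + 1) * \<theta>) \<le> \<eta> / 4"
  proof -
    have "\<theta> \<le> (\<eta> / (8 * B))\<^sup>2 / (L + 1)"
      by (simp only: \<theta>_def min.cobounded2)
    then have "(L + 1) * \<theta> \<le> (\<eta> / (8 * B))\<^sup>2"
      using L(1) by (simp add: pos_le_divide_eq mult.commute)
    then have "sqrt ((L + 1) * \<theta>) \<le> \<eta> / (8 * B)"
      using \<eta>(1) B(1) by (intro real_le_lsqrt) auto
    then show ?thesis
      using B(1) by (simp add: field_simps)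
  qed
  have P: "P > 0" "R\<^sup>2 \<le> real P * \<theta>"
  proof -
    have "R\<^sup>2 / \<theta> \<le> real P"
      unfolding P_def by linarith
    then show "R\<^sup>2 \<le> real P * \<theta>"
      using \<theta> by (simp add: pos_divide_le_eq)
  qed (simp add: P_def)
  show ?thesis
  proof (rule that)
    \<comment> \<open>There are \<open>P\<close> windows, each of duration at most
      \<open>L + 1\<close>.\<close>
    show "real P * (L + 1) > 0"
      using P L(1) by simp
    fix dt xs zs \<xi> k
    assume dt: "0 < dt" "dt < 1" and sch: "implicit_scheme A y \<tau> dt xs zs \<xi>"
      and E0: "scheme_energy xbar q (xs 0) (zs 0) \<le> R\<^sup>2" and k: "real P * (L + 1) / dt < real k"
    note y = unique_l1_minimizerD(1)[OF uniq]
    \<comment> \<open>Rounding up costs less than one step, so with \<open>dt < 1\<close> the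
      duration \<open>N * dt\<close> lies between \<open>L\<close> and \<open>L + 1\<close>.\<close>
    define N where "N = nat \<lceil>L / dt\<rceil>"
    have "L / dt \<le> real N" "real N \<le> L / dt + 1"
      unfolding N_def using L(1) dt(1) by (simp_all add: real_nat_ceiling_ge of_nat_ceiling)
    then have N: "L \<le> real N * dt" "real N * dt \<le> L + 1"
      using dt by (simp_all add: field_simps)
    have E: "scheme_energy xbar q (xs j) (zs j) \<le> R\<^sup>2" for j
      using scheme_energy_antimono[OF sch dt(1) y \<tau> cert, of 0 j] E0 by simp
    have "(norm (xs j - xbar))\<^sup>2 \<le> R\<^sup>2" "(norm (zs j - q))\<^sup>2 \<le> R\<^sup>2" for j
      using E[of j] zero_le_power2[of "norm (xs j - xbar)"] zero_le_power2[of "norm (zs j - q)"]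
      unfolding scheme_energy_def by linarith+
    then have xR: "norm (xs j - xbar) \<le> R" and zR: "norm (zs j - q) \<le> R" for j
      using R power2_le_imp_le by blast+
    define f where "f = (\<lambda>i. scheme_energy xbar q (xs (i * N)) (zs (i * N)))"
    have "f 0 - f P \<le> real P * \<theta>"
      using E0 P(2) scheme_energy_nonneg[of xbar q "xs (P * N)" "zs (P * N)"] by (simp add: f_def)
    then obtain i where i: "i < P" "f i - f (Suc i) \<le> \<theta>"
      using exists_small_drop[OF P(1)] by blast
    have "scheme_energy xbar q (xs (i * N)) (zs (i * N))
        - scheme_energy xbar q (xs (i * N + N)) (zs (i * N + N)) \<le> \<theta>"
      using i(2) by (simp add: f_def add.commute)
    moreover have "1 \<le> real N * dt"
      using N(1) L(1) by linarith
    ultimately obtain l \<Xi>' where l: "l < N" "\<And>j. \<bar>\<Xi>' $ j\<bar> \<le> 1"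
        "optimality_gap A \<tau> xbar \<Xi> (xs (i * N + Suc l))
          + certificate_residual A \<tau> xbar (zs (i * N + Suc l)) \<Xi>'
        \<le> \<theta> + \<theta> / \<tau> + 2 * R / (N * dt) + 2 * B * sqrt (N * dt * \<theta>)"
      using window_small_residual[OF sch dt(1) y \<tau> cert xR B] by blast
    define j where "j = i * N + Suc l"
    have "2 * R / (N * dt) \<le> \<eta> / 4"
    proof -
      have "8 * R \<le> real N * dt * \<eta>"
        using L(2) N(1) \<eta>(1) by (simp add: pos_divide_le_eq) (meson mult_right_mono less_imp_le order_trans)
      then show ?thesis
        using \<open>1 \<le> real N * dt\<close> by (simp add: pos_divide_le_eq mult.commute)
    qed
    moreover have "2 * B * sqrt (N * dt * \<theta>) \<le> 2 * B * sqrt ((L + 1) * \<theta>)"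
      using N(2) B(1) \<theta> by simp
    ultimately have "optimality_gap A \<tau> xbar \<Xi> (xs j) + certificate_residual A \<tau> xbar (zs j) \<Xi>' < \<eta>"
      using l(3) \<theta>1 \<theta>2 \<eta>(1) unfolding j_def by linarith
    then obtain q' \<Xi>'' where q': "dual_certificate A \<tau> xbar q' \<Xi>''"
        "scheme_energy xbar q' (xs j) (zs j) < \<delta>\<^sup>2"
      using \<eta>(2)[OF xR zR l(2)] unfolding scheme_energy_def by blast
    have "j \<le> k"
    proof -
      have "j \<le> Suc i * N"
        using l(1) by (simp add: j_def)
      also have "\<dots> \<le> P * N"
        using i(1) by (intro mult_right_mono) auto
      finally have "real j * dt \<le> real P * (real N * dt)"
        using dt(1) by (simp flip: mult.assoc of_nat_mult)
      also have "\<dots> \<le> real P * (L + 1)"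
        using N(2) by (intro mult_left_mono) auto
      also have "\<dots> < real k * dt"
        using k dt(1) by (simp add: pos_divide_less_eq)
      finally show ?thesis
        using dt(1) by simp
    qed
    \<comment> \<open>The energy is now measured from the certificate \<open>q'\<close> found near
      \<open>zs j\<close>, so its smallness at \<open>j\<close> persists up to
      \<open>k\<close>.\<close>
    then have "scheme_energy xbar q' (xs k) (zs k) < \<delta>\<^sup>2"
      using scheme_energy_antimono[OF sch dt(1) y \<tau> q'(1)] q'(2) by (meson le_less_trans)
    then have "(norm (xs k - xbar))\<^sup>2 < \<delta>\<^sup>2"
      using zero_le_power2[of "norm (zs k - q')"] unfolding scheme_energy_def by linarith
    then show "norm (xs k - xbar) < \<delta>"
      using \<delta> by (simp add: power2_less_imp_less)
  qed
qed

theorem theorem2p6: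
  fixes A :: "real ^ 'n ^ 'm" and y :: "real ^ 'm" and \<tau> :: real and xbar :: "real ^ 'n"
  assumes "CARD('m) < CARD('n)"
    and "rank A = CARD('m)"
    and "\<tau> > 0"
    and "unique_l1_minimizer A y xbar"
  shows "\<exists>T :: real \<Rightarrow> real ^ 'n \<Rightarrow> real \<Rightarrow> real.
    \<forall>\<delta> > 0. \<forall>x.
      T \<delta> x (onorm ((*v) (A ** transpose A))) > 0 \<and>
      (\<exists>h > 0. \<forall>dt xs zs \<xi>.
         0 < dt \<and> dt < h \<and> implicit_scheme A y \<tau> dt xs zs \<xi> \<and> xs 0 = x \<and> zs 0 = 0 \<longrightarrow>
         (\<forall>k. int k > \<lfloor>T \<delta> x (onorm ((*v) (A ** transpose A))) / dt\<rfloor> \<longrightarrow>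
              norm (xs k - xbar) < \<delta>))"
proof -
  obtain q \<Xi> where cert: "dual_certificate A \<tau> xbar q \<Xi>"
    using dual_certificate_exists[OF assms(3,4)] by blast
  have "\<exists>T > 0. \<forall>dt xs zs \<xi> k. 0 < dt \<and> dt < 1 \<and> implicit_scheme A y \<tau> dt xs zs \<xi>
      \<and> xs 0 = x \<and> zs 0 = 0 \<and> real k > T / dt \<longrightarrow> norm (xs k - xbar) < \<delta>"
    if "\<delta> > 0" for \<delta> x
  proof -
    \<comment> \<open>The initial energy depends only on \<open>x\<close> and the fixed certificate,
      hence so does the resulting bound on the whole orbit.\<close>
    define R where "R = sqrt (scheme_energy xbar q x 0)"
    have "R \<ge> 0" "scheme_energy xbar q x 0 \<le> R\<^sup>2"
      by (simp_all add: R_def scheme_energy_nonneg)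
    then show ?thesis
      using uniform_convergence_time[OF assms(3,4) cert that] by metis
  qed
  then obtain T where T: "\<And>\<delta> x. \<delta> > 0 \<Longrightarrow> T \<delta> x > 0 \<and> (\<forall>dt xs zs \<xi> k. 0 < dt \<and> dt < 1 \<and>
      implicit_scheme A y \<tau> dt xs zs \<xi> \<and> xs 0 = x \<and> zs 0 = 0 \<and> real k > T \<delta> x / dt
      \<longrightarrow> norm (xs k - xbar) < \<delta>)"
    by metis
  show ?thesis
  \<comment> \<open>\<open>A\<close> is fixed before \<open>T\<close> is chosen, so any dependence
    on its operator norm is already contained in \<open>T \<delta> x\<close>. The step bound is
    1.\<close>
  proof (intro exI[of _ "\<lambda>\<delta> x _. T \<delta> x"] allI impI conjI exI[of _ "1 :: real"])
    fix \<delta> :: real and x :: "real ^ 'n"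
    assume "\<delta> > 0"
    note T' = T[OF this, of x]
    show "T \<delta> x > 0"
      using T' by blast
    fix dt :: real and xs zs \<xi> and k :: nat
    assume *: "0 < dt \<and> dt < 1 \<and> implicit_scheme A y \<tau> dt xs zs \<xi> \<and> xs 0 = x \<and> zs 0 = 0"
    assume "\<lfloor>T \<delta> x / dt\<rfloor> < int k"
    then have "real k > T \<delta> x / dt"
      by linarith
    then show "norm (xs k - xbar) < \<delta>"
      using T' * by blast
  qed simp
qed

end
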